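(* Let $n \geq 1$. (1) The only continuous oriented Kakeya line set in $\mathbb{R}^{2n+1}$ is $\mathbb{R}^{2n+1}$ itself; that is, for every continuous map $\sigma: S^{2n} \to \mathbb{R}^{2n+1}$, $$|\sigma| = \bigcup_{x \in S^{2n}} (\sigma(x) + L_x) = \mathbb{R}^{2n+1}.$$ (2) On the other hand, for every bounded set $B \subseteq \mathbb{R}^{2n}$ there exists a continuous map $\sigma: S^{2n-1} \to \mathbb{R}^{2n}$ such that $|\sigma| = \bigcup_{x \in S^{2n-1}} (\sigma(x) + L_x)$ is disjoint from $B$; in particular $|\sigma|$ need not be all of $\mathbb{R}^{2n}$.
   Context: $S^{m-1}$ is the unit sphere in $\mathbb{R}^m$. For $x \in S^{m-1}$, $L_x = \mathbb{R}x$ is the line through the origin and $x$ (oriented in the direction from the origin to $x$; as a set it is just $\mathbb{R}x$). A continuous oriented Kakeya line configuration in $\mathbb{R}^m$ is a continuous map $\sigma: S^{m-1} \to \mathbb{R}^m$; its underlying space is $|\sigma| = \bigcup_{x \in S^{m-1}} (\sigma(x)+L_x)$. A continuous oriented Kakeya line set is a subset of $\mathbb{R}^m$ that contains $|\sigma|$ for some such $\sigma$. *)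

theory Defs
  imports "HOL-Analysis.Analysis"
begin

(* The orientation of the line does not affect the point set; it is reflected only in the fact
   that a configuration assigns independent base points to x and to -x. *)
definition line_dir :: "'a::euclidean_space \<Rightarrow> 'a set" where
  "line_dir x = {t *\<^sub>R x | t :: real. True}"

(* Only the values of \<sigma> on the unit sphere are relevant. *)
definition kakeya_line_config :: "('a::euclidean_space \<Rightarrow> 'a) \<Rightarrow> bool" where
  "kakeya_line_config \<sigma> \<longleftrightarrow> continuous_on (sphere 0 1) \<sigma>"

definition underlying_space :: "('a::euclidean_space \<Rightarrow> 'a) \<Rightarrow> 'a set" where
  "underlying_space \<sigma> = (\<Union>x\<in>sphere 0 1. (\<lambda>y. \<sigma> x + y) ` line_dir x)"

definition kakeya_line_set :: "'a::euclidean_space set \<Rightarrow> bool" where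
  "kakeya_line_set K \<longleftrightarrow> (\<exists>\<sigma>. kakeya_line_config \<sigma> \<and> underlying_space \<sigma> \<subseteq> K)"

end

theory Submission
  imports Defs "HOL-Homology.Homology"
begin

text \<open>
  If \<open>\<sigma>\<close> misses a point \<open>p\<close>, then \<open>p - \<sigma> x\<close> is nowhere parallel to \<open>x\<close>, so its component
  orthogonal to \<open>x\<close> is a nowhere vanishing tangent field on the sphere. Rotating along such a field
  is a homotopy from the identity to the antipodal map, which is impossible on an even-dimensional
  sphere because the antipodal map has degree \<open>-1\<close> there. In even dimension \<open>2n\<close> a linear complex
  structure \<open>J\<close> is such a field, and the lines \<open>R J x + \<real>x\<close> stay at distance \<open>R\<close> from the origin.
\<close>

subsection \<open>The degree of the antipodal map\<close>

lemma sum_squares_transpose: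
  fixes x :: "nat \<Rightarrow> real"
  assumes "i \<le> p" "j \<le> p"
  shows "(\<Sum>l\<le>p. (x (Transposition.transpose i j l))\<^sup>2) = (\<Sum>l\<le>p. (x l)\<^sup>2)"
proof -
  have "Transposition.transpose i j permutes {..p}"
    by (rule permutes_swap_id) (use assms in auto)
  then show ?thesis
    using sum.permute[of "Transposition.transpose i j" "{..p}" "\<lambda>l. (x l)\<^sup>2"]
    by (simp add: comp_def)
qed

text \<open>These swaps serve to conjugate a reflection in one coordinate into a reflection in
  another.\<close>

lemma continuous_map_nsphere_transpose:
  assumes "i \<le> p" "j \<le> p"
  shows "continuous_map (nsphere p) (nsphere p) (\<lambda>x. x \<circ> Transposition.transpose i j)"
proof -
  \<comment> \<open>Points of \<open>nsphere p\<close> are infinite sequences vanishing beyond index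
    \<open>p\<close>; the swap preserves this because it moves only indices up to
    \<open>p\<close>.\<close>
  have "Transposition.transpose i j l > p" if "l > p" for l
    using assms that by (simp add: Transposition.transpose_def)
  then show ?thesis
    using assms
    by (auto simp: nsphere continuous_map_in_subtopology continuous_map_componentwise_UNIV
        sum_squares_transpose
        intro!: continuous_map_from_subtopology continuous_map_product_projection)
qed

text \<open>The reflection in coordinate \<open>k\<close> is conjugate, by the swap of
  \<open>0\<close> and \<open>k\<close>, to the one in coordinate \<open>0\<close>, whose degree is
  known. The swap is an involution, so its degree squares to 1 and cancels.\<close>

lemma Brouwer_degree2_reflection_coordinate:
  assumes "k \<le> p"
  shows "Brouwer_degree2 p (\<lambda>x i. if i = k then - x i else x i) = -1"
proof -
  define s where "s \<equiv> \<lambda>x::nat\<Rightarrow>real. x \<circ> Transposition.transpose 0 k"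
  define r where "r \<equiv> \<lambda>k (x::nat\<Rightarrow>real) i. if i = k then - x i else x i"
  have s: "continuous_map (nsphere p) (nsphere p) s"
    unfolding s_def using assms by (intro continuous_map_nsphere_transpose) auto
  have r: "continuous_map (nsphere p) (nsphere p) (r k)" for k
    unfolding r_def by (rule continuous_map_nsphere_reflection)
  have "s \<circ> s = id"
    by (auto simp: s_def fun_eq_iff)
  then have ss: "Brouwer_degree2 p s * Brouwer_degree2 p s = 1"
    using Brouwer_degree2_compose[OF s s] by simp
  have "r k = s \<circ> (r 0 \<circ> s)"
    by (auto simp: r_def s_def fun_eq_iff Transposition.transpose_def)
  then have "Brouwer_degree2 p (r k) = Brouwer_degree2 p s * (Brouwer_degree2 p (r 0) * Brouwer_degree2 p s)"
    by (simp only: Brouwer_degree2_compose s r continuous_map_compose[OF s r])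
  moreover have "Brouwer_degree2 p (r 0) = -1"
    unfolding r_def by (rule Brouwer_degree2_reflection)
  ultimately have "Brouwer_degree2 p (r k) = -1"
    using ss by simp
  then show ?thesis
    by (simp add: r_def)
qed

text \<open>On the \<open>p\<close>-sphere the antipodal map is a composition of
  \<open>p + 1\<close> coordinate reflections, each of degree -1, and degree is
  multiplicative.\<close>

lemma Brouwer_degree2_antipodal: "Brouwer_degree2 p (\<lambda>x i. - x i) = (-1) ^ Suc p"
proof -
  \<comment> \<open>\<open>a k\<close> interpolates between the identity (\<open>k = 0\<close>) and
    the antipodal map (\<open>k = Suc p\<close>), gaining one reflection at each step.\<close>
  define a where "a \<equiv> \<lambda>k (x::nat\<Rightarrow>real) i. if i < k then - x i else x i"
  have "k \<le> Suc p \<Longrightarrow> continuous_map (nsphere p) (nsphere p) (a k) \<and> Brouwer_degree2 p (a k) = (-1) ^ k" for k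
  proof (induction k)
    case 0
    have "a 0 = id"
      by (auto simp: a_def)
    then show ?case
      by (simp only: Brouwer_degree2_id continuous_map_id power_0)
  next
    case (Suc k)
    have eq: "a (Suc k) = (\<lambda>x i. if i = k then - x i else x i) \<circ> a k"
      by (auto simp: a_def fun_eq_iff)
    have k: "k \<le> p" and IH: "continuous_map (nsphere p) (nsphere p) (a k)"
      "Brouwer_degree2 p (a k) = (-1) ^ k"
      using Suc by auto
    show ?case
      unfolding eq Brouwer_degree2_compose[OF IH(1) continuous_map_nsphere_reflection]
        Brouwer_degree2_reflection_coordinate[OF k] IH(2)
      by (intro conjI continuous_map_compose[OF IH(1) continuous_map_nsphere_reflection]) simp
  qed
  then have "Brouwer_degree2 p (a (Suc p)) = (-1) ^ Suc p"
    by blast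
  \<comment> \<open>The two maps agree only on the sphere, where coordinates beyond \<open>p\<close>
    are zero; the degree sees nothing else.\<close>
  moreover have "Brouwer_degree2 p (\<lambda>x i. - x i) = Brouwer_degree2 p (a (Suc p))"
    by (rule Brouwer_degree2_eq) (auto simp: a_def nsphere fun_eq_iff not_less)
  ultimately show ?thesis
    by simp
qed

subsection \<open>The hairy ball theorem\<close>

lemma norm_squared_Basis: "(norm x)\<^sup>2 = (\<Sum>b\<in>Basis. (x \<bullet> b)\<^sup>2)"
  unfolding power2_norm_eq_inner by (subst euclidean_inner) (simp only: power2_eq_square)

text \<open>Degree theory lives on \<open>nsphere p\<close>, so the sphere is moved there by
  coordinates along an enumerated basis. Oddness of \<open>e\<close> makes antipodes
  correspond.\<close>

lemma homeomorphic_maps_sphere_nsphere: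
  assumes "DIM('a::euclidean_space) = Suc p"
  obtains e :: "'a::euclidean_space \<Rightarrow> nat \<Rightarrow> real" and d
  where "homeomorphic_maps (top_of_set (sphere 0 1)) (nsphere p) e d" "\<And>x. e (- x) = (\<lambda>i. - e x i)"
proof -
  obtain b where b: "bij_betw b {..p} (Basis :: 'a set)"
    using assms finite_same_card_bij[of "{..p}" "Basis :: 'a set"] by auto
  have inj: "inj_on b {..p}" and img: "b ` {..p} = Basis"
    using b by (auto simp: bij_betw_def)
  \<comment> \<open>Padding with zeros beyond \<open>p\<close> puts \<open>e x\<close> into the
    sequence model; hence \<open>e (d y) = y\<close> is claimed only on the sphere.\<close>
  define e where "e \<equiv> \<lambda>(x::'a) i. if i \<le> p then x \<bullet> b i else 0"
  define d where "d \<equiv> \<lambda>y::nat\<Rightarrow>real. \<Sum>i\<le>p. y i *\<^sub>R b i"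
  have sum_Basis: "(\<Sum>i\<le>p. f (b i)) = (\<Sum>c\<in>Basis. f c)" for f :: "'a \<Rightarrow> 'c::comm_monoid_add"
    using sum.reindex_bij_betw[OF b, of f] by simp
  have de: "d (e x) = x" for x
  proof -
    have "d (e x) = (\<Sum>i\<le>p. (x \<bullet> b i) *\<^sub>R b i)"
      by (simp add: d_def e_def)
    also have "\<dots> = x"
      using sum_Basis[of "\<lambda>c. (x \<bullet> c) *\<^sub>R c"] by (simp add: euclidean_representation)
    finally show ?thesis .
  qed
  have db: "d y \<bullet> b i = y i" if "i \<le> p" for y i
  proof -
    have "d y \<bullet> b i = (\<Sum>j\<le>p. y j * (b j \<bullet> b i))"
      by (simp add: d_def inner_sum_left)
    also have "\<dots> = (\<Sum>j\<le>p. if j = i then y j else 0)"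
    proof (rule sum.cong)
      fix j assume "j \<in> {..p}"
      then have "b j \<in> Basis" "b i \<in> Basis" "b j = b i \<longleftrightarrow> j = i"
        using img inj that by (auto simp: inj_on_eq_iff)
      then show "y j * (b j \<bullet> b i) = (if j = i then y j else 0)"
        by (simp add: inner_Basis)
    qed simp
    finally show ?thesis
      using that by simp
  qed
  have ed: "e (d y) = y" if "y \<in> topspace (nsphere p)" for y
    using that by (auto simp: e_def db nsphere fun_eq_iff not_le)
  have norm_e: "(\<Sum>i\<le>p. (e x i)\<^sup>2) = (norm x)\<^sup>2" for x
  proof -
    have "(\<Sum>i\<le>p. (e x i)\<^sup>2) = (\<Sum>i\<le>p. (x \<bullet> b i)\<^sup>2)"
      by (simp add: e_def)
    also have "\<dots> = (norm x)\<^sup>2"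
      by (simp only: sum_Basis[of "\<lambda>c. (x \<bullet> c)\<^sup>2"] norm_squared_Basis)
    finally show ?thesis .
  qed
  have "continuous_map (top_of_set (sphere 0 1)) (nsphere p) e"
  proof -
    have "continuous_map (top_of_set (sphere 0 1)) euclideanreal (\<lambda>x. e x i)" for i
      by (cases "i \<le> p") (auto simp: e_def intro!: continuous_intros)
    then show ?thesis
      by (auto simp: nsphere continuous_map_in_subtopology continuous_map_componentwise_UNIV norm_e)
        (simp add: e_def)
  qed
  moreover have "continuous_map (nsphere p) (top_of_set (sphere 0 1)) d"
  proof -
    have "continuous_map (nsphere p) euclidean (\<lambda>y. y i *\<^sub>R b i)" for i
    proof -
      have "continuous_map euclideanreal euclidean (\<lambda>r. r *\<^sub>R b i)"
        by (auto intro!: continuous_intros)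
      from continuous_map_compose[OF continuous_map_nsphere_projection this]
      show ?thesis
        by (simp add: comp_def)
    qed
    then have "continuous_map (nsphere p) euclidean d"
      unfolding d_def by (intro continuous_map_sum) auto
    moreover have "norm (d y) = 1" if "y \<in> topspace (nsphere p)" for y
    proof -
      have "(norm (d y))\<^sup>2 = 1\<^sup>2"
        using norm_e[of "d y"] ed[OF that] that by (simp add: nsphere)
      then show ?thesis
        by (simp only: power2_eq_iff_nonneg norm_ge_zero zero_le_one)
    qed
    ultimately show ?thesis
      by (auto simp: continuous_map_in_subtopology)
  qed
  ultimately have "homeomorphic_maps (top_of_set (sphere 0 1)) (nsphere p) e d"
    by (simp add: homeomorphic_maps_def de ed)
  moreover have "e (- x) = (\<lambda>i. - e x i)" for x
    by (auto simp: e_def)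
  ultimately show thesis
    by (rule that)
qed

text \<open>In odd dimension \<open>p + 1\<close> the antipodal map has degree -1, whereas the
  identity has degree 1, and homotopic maps have equal degree.\<close>

lemma antipodal_not_homotopic_id:
  assumes "odd DIM('a::euclidean_space)"
  shows "\<not> homotopic_with_canon (\<lambda>_. True) (sphere (0::'a) 1) (sphere 0 1) id uminus"
proof
  assume hom: "homotopic_with_canon (\<lambda>_. True) (sphere (0::'a) 1) (sphere 0 1) id uminus"
  obtain p where p: "DIM('a) = Suc p" "even p"
    using assms by (metis DIM_positive even_Suc gr0_implies_Suc)
  obtain e :: "'a \<Rightarrow> nat \<Rightarrow> real" and d
    where ed: "homeomorphic_maps (top_of_set (sphere 0 1)) (nsphere p) e d"
      and e_minus: "\<And>x. e (- x) = (\<lambda>i. - e x i)"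
    using homeomorphic_maps_sphere_nsphere[OF p(1)] by blast
  have e: "continuous_map (top_of_set (sphere 0 1)) (nsphere p) e"
    and d: "continuous_map (nsphere p) (top_of_set (sphere 0 1)) d"
    and inv: "\<And>y. y \<in> topspace (nsphere p) \<Longrightarrow> e (d y) = y"
    using ed by (auto simp: homeomorphic_maps_def)
  \<comment> \<open>Conjugating the homotopy by \<open>e\<close> and \<open>d\<close> transports it
    to \<open>nsphere p\<close>.\<close>
  have "homotopic_with (\<lambda>_. True) (nsphere p) (nsphere p) (e \<circ> (id \<circ> d)) (e \<circ> (uminus \<circ> d))"
    by (rule homotopic_with_compose_continuous_map_left
        [OF homotopic_with_compose_continuous_map_right[OF hom d] e]) auto
  then have "Brouwer_degree2 p (e \<circ> (id \<circ> d)) = Brouwer_degree2 p (e \<circ> (uminus \<circ> d))"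
    by (rule Brouwer_degree2_homotopic)
  moreover have "Brouwer_degree2 p (e \<circ> (id \<circ> d)) = Brouwer_degree2 p id"
    by (rule Brouwer_degree2_eq) (simp add: inv)
  moreover have "Brouwer_degree2 p (e \<circ> (uminus \<circ> d)) = Brouwer_degree2 p (\<lambda>x i. - x i)"
    by (rule Brouwer_degree2_eq) (simp add: inv e_minus)
  ultimately show False
    using p(2) by (simp add: Brouwer_degree2_antipodal)
qed

theorem hairy_ball:
  fixes v :: "'a::euclidean_space \<Rightarrow> 'a"
  assumes odd: "odd DIM('a)" and cont: "continuous_on (sphere 0 1) v"
    and tangent: "\<And>x. norm x = 1 \<Longrightarrow> x \<bullet> v x = 0"
  obtains x where "norm x = 1" "v x = 0"
proof (rule ccontr)
  assume *: "\<not> thesis"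
  then have nz: "v x \<noteq> 0" if "norm x = 1" for x
    using that \<open>\<And>x. norm x = 1 \<Longrightarrow> v x = 0 \<Longrightarrow> thesis\<close> by blast
  define w where "w \<equiv> \<lambda>x. v x /\<^sub>R norm (v x)"
  \<comment> \<open>For fixed \<open>x\<close> this runs along the half great circle from
    \<open>x\<close> to \<open>- x\<close> that leaves \<open>x\<close> in the unit tangent
    direction \<open>w x\<close>.\<close>
  define h where "h \<equiv> \<lambda>(t, x). cos (pi * t) *\<^sub>R x + sin (pi * t) *\<^sub>R w x"
  have "continuous_on (sphere 0 1) w"
    unfolding w_def using nz by (intro continuous_intros cont) auto
  then have cw: "continuous_on ({0..1::real} \<times> sphere 0 1) (\<lambda>z. w (snd z))"
    by (rule continuous_on_compose2) (auto intro: continuous_intros)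
  have conth: "continuous_on ({0..1} \<times> sphere 0 1) h"
    unfolding h_def case_prod_unfold by (intro continuous_intros cw)
  have "norm (h (t, x)) = 1" if "norm x = 1" for t x
  proof -
    have "norm (w x) = 1" "x \<bullet> w x = 0"
      using nz[OF that] tangent[OF that] by (auto simp: w_def)
    then have "(norm (h (t, x)))\<^sup>2 = 1\<^sup>2"
      using that norm_add_Pythagorean[of "cos (pi * t) *\<^sub>R x" "sin (pi * t) *\<^sub>R w x"]
      by (simp add: h_def orthogonal_def)
    then show ?thesis
      by (simp only: power2_eq_iff_nonneg norm_ge_zero zero_le_one)
  qed
  then have "h \<in> {0..1} \<times> sphere 0 1 \<rightarrow> sphere 0 1"
    by auto
  moreover have "h (0, x) = id x" "h (1, x) = - x" for x
    by (auto simp: h_def)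
  ultimately have "homotopic_with_canon (\<lambda>_. True) (sphere (0::'a) 1) (sphere 0 1) id uminus"
    using conth by (subst homotopic_with) (auto intro!: exI[of _ h])
  with antipodal_not_homotopic_id[OF odd] show False
    by blast
qed

subsection \<open>Kakeya line configurations\<close>

lemma mem_underlying_space:
  "p \<in> underlying_space \<sigma> \<longleftrightarrow> (\<exists>x t. norm x = 1 \<and> p = \<sigma> x + t *\<^sub>R x)"
  by (auto simp: underlying_space_def line_dir_def image_iff Bex_def)

text \<open>A point \<open>p\<close> lies on the line through \<open>\<sigma> x\<close> in direction
  \<open>x\<close> exactly when the part of \<open>p - \<sigma> x\<close> orthogonal to
  \<open>x\<close> vanishes; the hairy ball theorem supplies such an \<open>x\<close>.\<close>

lemma underlying_space_odd:
  fixes \<sigma> :: "'a::euclidean_space \<Rightarrow> 'a"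
  assumes "odd DIM('a)" "kakeya_line_config \<sigma>"
  shows "underlying_space \<sigma> = UNIV"
proof -
  have "p \<in> underlying_space \<sigma>" for p
  proof -
    define v where "v \<equiv> \<lambda>x. (p - \<sigma> x) - (x \<bullet> (p - \<sigma> x)) *\<^sub>R x"
    have "continuous_on (sphere 0 1) v"
      using assms(2) unfolding v_def kakeya_line_config_def by (intro continuous_intros)
    moreover have "x \<bullet> v x = 0" if "norm x = 1" for x
      using that by (simp add: v_def inner_diff_right norm_eq_1)
    ultimately obtain x where "norm x = 1" "v x = 0"
      using hairy_ball[OF assms(1)] by blast
    then have "norm x = 1" "p = \<sigma> x + (x \<bullet> (p - \<sigma> x)) *\<^sub>R x"
      by (simp_all add: v_def algebra_simps)
    then show ?thesis
      unfolding mem_underlying_space by blast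
  qed
  then show ?thesis
    by blast
qed

lemma kakeya_line_set_odd_iff:
  fixes K :: "'a::euclidean_space set"
  assumes "odd DIM('a)"
  shows "kakeya_line_set K \<longleftrightarrow> K = UNIV"
proof
  assume "kakeya_line_set K"
  then show "K = UNIV"
    using underlying_space_odd[OF assms] by (auto simp: kakeya_line_set_def)
next
  assume "K = UNIV"
  then show "kakeya_line_set K"
    by (auto simp: kakeya_line_set_def kakeya_line_config_def intro!: exI[of _ "\<lambda>_. 0"])
qed

text \<open>Splitting the basis into two halves matched by a bijection \<open>g\<close> gives
  coordinate planes, and \<open>J\<close> is a quarter turn in each of them.\<close>

lemma even_dim_complex_structure:
  assumes "even DIM('a::euclidean_space)"
  obtains J :: "'a::euclidean_space \<Rightarrow> 'a"
  where "continuous_on UNIV J" "\<And>x. x \<bullet> J x = 0" "\<And>x. norm (J x) = norm x"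
proof -
  obtain n where n: "DIM('a) = n + n"
    using assms by (metis evenE mult_2)
  then obtain A where A: "A \<subseteq> (Basis :: 'a set)" "card A = n" "finite A"
    using obtain_subset_with_card_n[of n "Basis :: 'a set"] by auto
  have "card (Basis - A) = n"
    using A n by (simp add: card_Diff_subset)
  then obtain g where g: "bij_betw g A (Basis - A)"
    using A finite_same_card_bij[of A "Basis - A"] by auto
  then have inj: "inj_on g A" and img: "g ` A = Basis - A"
    by (auto simp: bij_betw_def)
  define J where "J \<equiv> \<lambda>x::'a. \<Sum>a\<in>A. (x \<bullet> g a) *\<^sub>R a - (x \<bullet> a) *\<^sub>R g a"
  have "continuous_on UNIV J"
    unfolding J_def by (intro continuous_intros)
  \<comment> \<open>Within each plane the two products cancel.\<close>
  moreover have "x \<bullet> J x = 0" for x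
    by (simp add: J_def inner_sum_right inner_diff_right)
  moreover have "norm (J x) = norm x" for x
  proof -
    \<comment> \<open>The squared norm is grouped by planes, so that the quarter turn only exchanges
      the two squares in each summand.\<close>
    have split: "(norm y)\<^sup>2 = (\<Sum>a\<in>A. (y \<bullet> a)\<^sup>2 + (y \<bullet> g a)\<^sup>2)" for y :: 'a
    proof -
      have "(norm y)\<^sup>2 = (\<Sum>c\<in>Basis. (y \<bullet> c)\<^sup>2)"
        by (rule norm_squared_Basis)
      also have "\<dots> = (\<Sum>a\<in>A. (y \<bullet> a)\<^sup>2) + (\<Sum>c\<in>Basis - A. (y \<bullet> c)\<^sup>2)"
        using A(1) by (simp add: sum.subset_diff add.commute)
      also have "(\<Sum>c\<in>Basis - A. (y \<bullet> c)\<^sup>2) = (\<Sum>a\<in>A. (y \<bullet> g a)\<^sup>2)"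
        using sum.reindex_bij_betw[OF g, of "\<lambda>c. (y \<bullet> c)\<^sup>2"] by simp
      finally show ?thesis
        by (simp add: sum.distrib)
    qed
    have "J x \<bullet> c = x \<bullet> g c \<and> J x \<bullet> g c = - (x \<bullet> c)" if c: "c \<in> A" for c
    proof -
      have gB: "g a \<in> Basis - A" if "a \<in> A" for a
        using that img by blast
      have eqs: "a \<bullet> c = (if a = c then 1 else 0)" "g a \<bullet> c = 0" "a \<bullet> g c = 0"
        "g a \<bullet> g c = (if a = c then 1 else 0)" if "a \<in> A" for a
        using that c gB[OF that] gB[OF c] subsetD[OF A(1) that] subsetD[OF A(1) c] inj
        by (auto simp: inner_Basis inj_on_eq_iff)
      have "J x \<bullet> c = (\<Sum>a\<in>A. if a = c then x \<bullet> g a else 0)"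
        unfolding J_def inner_sum_left by (intro sum.cong) (auto simp: inner_diff_left eqs)
      moreover have "J x \<bullet> g c = (\<Sum>a\<in>A. if a = c then - (x \<bullet> a) else 0)"
        unfolding J_def inner_sum_left by (intro sum.cong) (auto simp: inner_diff_left eqs)
      ultimately show ?thesis
        using c A(3) by simp
    qed
    then have "(norm (J x))\<^sup>2 = (norm x)\<^sup>2"
      by (simp add: split add.commute)
    then show ?thesis
      by simp
  qed
  ultimately show thesis
    by (rule that)
qed

lemma kakeya_line_config_even_avoids_bounded:
  fixes B :: "'a::euclidean_space set"
  assumes "even DIM('a)" "bounded B"
  obtains \<sigma> :: "'a \<Rightarrow> 'a" where "kakeya_line_config \<sigma>" "underlying_space \<sigma> \<inter> B = {}"
proof -
  obtain J :: "'a \<Rightarrow> 'a" where J: "continuous_on UNIV J" "\<And>x. x \<bullet> J x = 0" "\<And>x. norm (J x) = norm x"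
    using even_dim_complex_structure[OF assms(1)] by blast
  \<comment> \<open>The bound on \<open>B\<close> is strict, so that lines at distance at least
    \<open>R\<close> from the origin avoid \<open>B\<close>.\<close>
  obtain R where R: "R > 0" "\<And>y. y \<in> B \<Longrightarrow> norm y < R"
    using assms(2) by (metis bounded_pos_less)
  define \<sigma> where "\<sigma> \<equiv> \<lambda>x. R *\<^sub>R J x"
  have config: "kakeya_line_config \<sigma>"
    unfolding kakeya_line_config_def \<sigma>_def
    by (intro continuous_intros continuous_on_subset[OF J(1)]) auto
  \<comment> \<open>The base point \<open>R *\<^sub>R J x\<close> is orthogonal to the direction
    \<open>x\<close>, so it is the point of its line nearest to the origin.\<close>
  have "R \<le> norm (\<sigma> x + t *\<^sub>R x)" if "norm x = 1" for x t
  proof -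
    have "(norm (\<sigma> x + t *\<^sub>R x))\<^sup>2 = R\<^sup>2 + t\<^sup>2"
      using norm_add_Pythagorean[of "\<sigma> x" "t *\<^sub>R x"] that J(2)[of x] J(3)[of x]
      by (simp add: \<sigma>_def orthogonal_def inner_commute)
    then have "R\<^sup>2 \<le> (norm (\<sigma> x + t *\<^sub>R x))\<^sup>2"
      by simp
    then show ?thesis
      by (rule power2_le_imp_le) simp
  qed
  then have "R \<le> norm y" if "y \<in> underlying_space \<sigma>" for y
    using that unfolding mem_underlying_space by blast
  then have "underlying_space \<sigma> \<inter> B = {}"
    using R(2) by (meson disjoint_iff not_le)
  with config show thesis
    by (rule that)
qed

text \<open>Dimensions are carried by the index types \<open>'m\<close> and \<open>'k\<close>, so
  each parity claim is conditional on the cardinality of its own type.\<close>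

theorem theorem1p2:
  fixes n :: nat
  assumes "n \<ge> 1"
  shows "(CARD('m::finite) = 2 * n + 1 \<longrightarrow>
           (\<forall>K :: (real ^ 'm) set. kakeya_line_set K \<longleftrightarrow> K = UNIV) \<and>
           (\<forall>\<sigma> :: real ^ 'm \<Rightarrow> real ^ 'm. kakeya_line_config \<sigma> \<longrightarrow> underlying_space \<sigma> = UNIV)) \<and>
         (CARD('k::finite) = 2 * n \<longrightarrow>
           (\<forall>B :: (real ^ 'k) set. bounded B \<longrightarrow>
             (\<exists>\<sigma>. kakeya_line_config \<sigma> \<and> underlying_space \<sigma> \<inter> B = {})) \<and>
           (\<exists>\<sigma> :: real ^ 'k \<Rightarrow> real ^ 'k. kakeya_line_config \<sigma> \<and> underlying_space \<sigma> \<noteq> UNIV))"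
proof (intro conjI impI)
  assume "CARD('m) = 2 * n + 1"
  then have "odd DIM(real ^ 'm)"
    by simp
  then show "\<forall>K :: (real ^ 'm) set. kakeya_line_set K \<longleftrightarrow> K = UNIV"
    and "\<forall>\<sigma> :: real ^ 'm \<Rightarrow> real ^ 'm. kakeya_line_config \<sigma> \<longrightarrow> underlying_space \<sigma> = UNIV"
    using kakeya_line_set_odd_iff underlying_space_odd by blast+
next
  assume "CARD('k) = 2 * n"
  then have ev: "even DIM(real ^ 'k)"
    by simp
  then show "\<forall>B :: (real ^ 'k) set. bounded B \<longrightarrow>
      (\<exists>\<sigma>. kakeya_line_config \<sigma> \<and> underlying_space \<sigma> \<inter> B = {})"
    by (blast intro: kakeya_line_config_even_avoids_bounded)
  \<comment> \<open>Avoiding the single point 0 already gives a configuration that does not fill the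
    space.\<close>
  have "bounded {0 :: real ^ 'k}"
    by simp
  then obtain \<sigma> :: "real ^ 'k \<Rightarrow> real ^ 'k"
    where "kakeya_line_config \<sigma>" "underlying_space \<sigma> \<inter> {0} = {}"
    using kakeya_line_config_even_avoids_bounded[OF ev] by blast
  then show "\<exists>\<sigma> :: real ^ 'k \<Rightarrow> real ^ 'k. kakeya_line_config \<sigma> \<and> underlying_space \<sigma> \<noteq> UNIV"
    by blast
qed

end
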